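(* Let $(X,d)$ be a quasi-metric space such that $\tau(d)=\tau(\bar{d})$. Then $(X,d)$ is a UC space if and only if the following holds: for every closed subset $A\subseteq X$ and every function $f:(A,d)\to(\mathbb{R},|\cdot|)$ which is uniformly continuous and never zero, the function $\frac{1}{f}:(A,d)\to(\mathbb{R},|\cdot|)$ is uniformly continuous.
   Context: A quasi-metric on a set $X$ is a function $d:X\times X\to\mathbb{R}$ with, for all $x,y,z\in X$: $d(x,y)\ge 0$ and $d(x,x)=0$; $d(x,y)=0=d(y,x)$ implies $x=y$; and $d(x,y)\le d(x,z)+d(z,y)$ (symmetry is not required). The conjugate quasi-metric is $\bar d(x,y)=d(y,x)$. The forward topology $\tau(d)$ is generated by the forward balls $B^{+}(x,\epsilon)=\{y\in X: d(x,y)<\epsilon\}$, and the backward topology $\tau(\bar d)$ by the backward balls $B^{-}(x,\epsilon)=\{y\in X: d(y,x)<\epsilon\}$. Closed subsets of $X$ are with respect to $\tau(d)$. For $A\subseteq X$, $(A,d)$ denotes $A$ with the restriction of $d$. A function $f:(X,d)\to(\mathbb{R},|\cdot|)$ is forward continuous if it is continuous for $\tau(d)$ and the usual topology of $\mathbb{R}$; it is uniformly continuous if for every $\epsilon>0$ there is $\delta>0$ such that $d(x,y)<\delta$ implies $|f(x)-f(y)|<\epsilon$ (similarly for functions on $(A,d)$). $(X,d)$ is a UC space if every forward continuous $f:(X,d)\to(\mathbb{R},|\cdot|)$ is uniformly continuous. *)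

theory Defs
  imports "HOL-Analysis.Analysis"
begin

locale quasi_metric_space =
  fixes X :: "'a set" and d :: "'a \<Rightarrow> 'a \<Rightarrow> real"
  assumes nonneg: "\<lbrakk>x \<in> X; y \<in> X\<rbrakk> \<Longrightarrow> 0 \<le> d x y"
    and self_zero: "x \<in> X \<Longrightarrow> d x x = 0"
    and separated: "\<lbrakk>x \<in> X; y \<in> X; d x y = 0; d y x = 0\<rbrakk> \<Longrightarrow> x = y"
    and triangle: "\<lbrakk>x \<in> X; y \<in> X; z \<in> X\<rbrakk> \<Longrightarrow> d x y \<le> d x z + d z y"

definition conjugate :: "('a \<Rightarrow> 'a \<Rightarrow> real) \<Rightarrow> 'a \<Rightarrow> 'a \<Rightarrow> real" where
  "conjugate d x y = d y x"

definition forward_ball :: "'a set \<Rightarrow> ('a \<Rightarrow> 'a \<Rightarrow> real) \<Rightarrow> 'a \<Rightarrow> real \<Rightarrow> 'a set" where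
  "forward_ball X d x e = {y \<in> X. d x y < e}"

text \<open>
  The backward balls are the forward balls of the conjugate, so the backward topology
  is \<open>qm_topology X (conjugate d)\<close>.
\<close>
definition qm_topology :: "'a set \<Rightarrow> ('a \<Rightarrow> 'a \<Rightarrow> real) \<Rightarrow> 'a topology" where
  "qm_topology X d = topology_generated_by {forward_ball X d x e | x e. x \<in> X \<and> 0 < e}"

lemma (in quasi_metric_space) topspace_qm_topology: "topspace (qm_topology X d) = X"
proof -
  have "x \<in> forward_ball X d x 1" if "x \<in> X" for x
    using that self_zero by (simp add: forward_ball_def)
  moreover have "(0::real) < 1" by simp
  ultimately have "X \<subseteq> \<Union>{forward_ball X d x e | x e. x \<in> X \<and> 0 < e}"
    by blast
  then show ?thesis
    by (auto simp: qm_topology_def forward_ball_def)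
qed

text \<open>
  Functions are total in HOL; only the values of \<open>f\<close> on \<open>A\<close> matter here.
\<close>
definition qm_uniformly_continuous :: "'a set \<Rightarrow> ('a \<Rightarrow> 'a \<Rightarrow> real) \<Rightarrow> ('a \<Rightarrow> real) \<Rightarrow> bool" where
  "qm_uniformly_continuous A d f \<longleftrightarrow>
    (\<forall>\<epsilon>>0. \<exists>\<delta>>0. \<forall>x\<in>A. \<forall>y\<in>A. d x y < \<delta> \<longrightarrow> \<bar>f x - f y\<bar> < \<epsilon>)"

definition UC_space :: "'a set \<Rightarrow> ('a \<Rightarrow> 'a \<Rightarrow> real) \<Rightarrow> bool" where
  "UC_space X d \<longleftrightarrow>
    (\<forall>f. continuous_map (qm_topology X d) euclideanreal f \<longrightarrow> qm_uniformly_continuous X d f)"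

end

(*
  The coincidence of the forward and backward topologies makes X metrizable by the symmetrized
  distance d(x,y) + d(y,x). If X is UC and f is uniformly continuous without zeros on a closed A,
  then 1/f is continuous on A, so it extends to X by Tietze and the extension is uniformly
  continuous. Conversely, if a continuous g is not uniformly continuous, there are x_n, y_n with
  d(x_n,y_n) -> 0 and |g x_n - g y_n| >= e. The countable set A of all these points has no
  accumulation point, so it is closed and every function on A that tends to 0 along an enumeration
  of A is uniformly continuous. Taking 1/(h+1) with h an injection of A into the natural numbers,
  the reciprocal h + 1 separates x_n from y_n by at least 1 for every n.
*)
theory Submission
  imports Defs
begin

section \<open>Positive functions vanishing at infinity on a discrete set\<close>

lemma finite_positive_lower_bound:
  fixes k :: "'b \<Rightarrow> real"
  assumes "finite F" and "\<And>z. z \<in> F \<Longrightarrow> 0 < k z"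
  obtains r where "0 < r" and "\<And>z. z \<in> F \<Longrightarrow> r \<le> k z"
proof
  show "0 < Min (insert 1 (k ` F))"
    using assms by simp
  show "Min (insert 1 (k ` F)) \<le> k z" if "z \<in> F" for z
    using that assms(1) by simp
qed

text \<open>Only finitely many points have value at least \<open>\<epsilon>\<close>, so one
  \<open>\<delta>\<close> isolates all of them, for distances in either direction. Two distinct
  points at distance below \<open>\<delta>\<close> then both have values strictly between 0 and
  \<open>\<epsilon>\<close>.\<close>

lemma uniformly_continuous_vanishing_on_discrete:
  fixes f :: "'a \<Rightarrow> real"
  assumes iso: "\<And>p. p \<in> A \<Longrightarrow> \<exists>\<delta>>0. \<forall>z\<in>A. d p z < \<delta> \<or> d z p < \<delta> \<longrightarrow> z = p"
    and pos: "\<And>p. p \<in> A \<Longrightarrow> 0 < f p"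
    and fin: "\<And>\<epsilon>. 0 < \<epsilon> \<Longrightarrow> finite {p \<in> A. \<epsilon> \<le> f p}"
  shows "qm_uniformly_continuous A d f"
  unfolding qm_uniformly_continuous_def
proof (intro allI impI)
  fix \<epsilon> :: real assume "0 < \<epsilon>"
  obtain k where k: "\<And>p. p \<in> A \<Longrightarrow> 0 < k p"
    "\<And>p z. p \<in> A \<Longrightarrow> z \<in> A \<Longrightarrow> d p z < k p \<or> d z p < k p \<Longrightarrow> z = p"
    using iso by metis
  obtain \<delta> where \<delta>: "0 < \<delta>" "\<And>p. p \<in> {p \<in> A. \<epsilon> \<le> f p} \<Longrightarrow> \<delta> \<le> k p"
    using finite_positive_lower_bound[OF fin[OF \<open>0 < \<epsilon>\<close>], of k] k(1) by blast
  have "\<bar>f a - f b\<bar> < \<epsilon>" if ab: "a \<in> A" "b \<in> A" "d a b < \<delta>" for a b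
  proof (cases "\<epsilon> \<le> f a \<or> \<epsilon> \<le> f b")
    case True
    then have "a = b"
    proof
      assume "\<epsilon> \<le> f a"
      then have "d a b < k a" using \<delta>(2)[of a] ab by simp
      then show "a = b" using k(2)[of a b] ab by blast
    next
      assume "\<epsilon> \<le> f b"
      then have "d a b < k b" using \<delta>(2)[of b] ab by simp
      then show "a = b" using k(2)[of b a] ab by blast
    qed
    then show ?thesis using \<open>0 < \<epsilon>\<close> by simp
  next
    case False
    then show ?thesis using pos[OF ab(1)] pos[OF ab(2)] by linarith
  qed
  then show "\<exists>\<delta>>0. \<forall>x\<in>A. \<forall>y\<in>A. d x y < \<delta> \<longrightarrow> \<bar>f x - f y\<bar> < \<epsilon>"
    using \<delta>(1) by blast
qed

section \<open>Open sets, continuity and closed sets in terms of forward balls\<close>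

context quasi_metric_space
begin

lemma quasi_metric_space_conjugate: "quasi_metric_space X (conjugate d)"
  using nonneg self_zero separated triangle
  by unfold_locales (auto simp: conjugate_def add.commute)

lemma openin_forward_ball:
  "x \<in> X \<Longrightarrow> 0 < e \<Longrightarrow> openin (qm_topology X d) (forward_ball X d x e)"
  unfolding qm_topology_def by (rule topology_generated_by_Basis) auto

text \<open>The balls are given only as a subbase. By the triangle inequality the ball of radius
  \<open>e - d y x\<close> about a point \<open>x\<close> of \<open>forward_ball X d y e\<close>
  stays inside the latter, which makes them a base.\<close>

lemma openin_qm_topology:
  "openin (qm_topology X d) U \<longleftrightarrow> U \<subseteq> X \<and> (\<forall>x\<in>U. \<exists>e>0. forward_ball X d x e \<subseteq> U)"
proof
  assume open_U: "openin (qm_topology X d) U"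
  then have "U \<subseteq> X"
    using openin_subset topspace_qm_topology by blast
  moreover have "generate_topology_on {forward_ball X d x e | x e. x \<in> X \<and> 0 < e} U"
    using open_U by (simp add: qm_topology_def openin_topology_generated_by)
  then have "\<forall>x\<in>U. \<exists>e>0. forward_ball X d x e \<subseteq> U"
  proof induction
    case Empty
    then show ?case by simp
  next
    case (Int a b)
    show ?case
    proof
      fix x assume "x \<in> a \<inter> b"
      with Int obtain e1 e2 where "e1 > 0" "forward_ball X d x e1 \<subseteq> a"
        "e2 > 0" "forward_ball X d x e2 \<subseteq> b" by blast
      then show "\<exists>e>0. forward_ball X d x e \<subseteq> a \<inter> b"
        by (intro exI[of _ "min e1 e2"]) (auto simp: forward_ball_def)
    qed
  next
    case (UN K)
    then show ?case by (metis (no_types, lifting) Union_iff Sup_upper2)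
  next
    case (Basis s)
    then obtain y e where s: "s = forward_ball X d y e" "y \<in> X" by auto
    show ?case
    proof
      fix x assume x: "x \<in> s"
      have "forward_ball X d x (e - d y x) \<subseteq> s"
      proof
        fix z assume z: "z \<in> forward_ball X d x (e - d y x)"
        with x s triangle[of y z x] show "z \<in> s"
          by (auto simp: forward_ball_def)
      qed
      moreover have "0 < e - d y x"
        using x s by (simp add: forward_ball_def)
      ultimately show "\<exists>e>0. forward_ball X d x e \<subseteq> s" by blast
    qed
  qed
  ultimately show "U \<subseteq> X \<and> (\<forall>x\<in>U. \<exists>e>0. forward_ball X d x e \<subseteq> U)" by blast
next
  assume U: "U \<subseteq> X \<and> (\<forall>x\<in>U. \<exists>e>0. forward_ball X d x e \<subseteq> U)"
  show "openin (qm_topology X d) U"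
  proof (subst openin_subopen, intro ballI)
    fix x assume "x \<in> U"
    with U obtain e where "e > 0" "forward_ball X d x e \<subseteq> U" "x \<in> X" by blast
    then show "\<exists>T. openin (qm_topology X d) T \<and> x \<in> T \<and> T \<subseteq> U"
      using openin_forward_ball[of x e] self_zero
      by (intro exI[of _ "forward_ball X d x e"]) (auto simp: forward_ball_def)
  qed
qed

text \<open>The subtopology serves both uses: a closed \<open>A\<close> for the Tietze extension,
  and \<open>UNIV\<close> for functions on all of \<open>X\<close>.\<close>

lemma continuous_map_qm_topology:
  "continuous_map (subtopology (qm_topology X d) A) euclideanreal f \<longleftrightarrow>
    (\<forall>x\<in>X \<inter> A. \<forall>\<epsilon>>0. \<exists>\<delta>>0. \<forall>y\<in>X \<inter> A. d x y < \<delta> \<longrightarrow> \<bar>f x - f y\<bar> < \<epsilon>)"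
  (is "?L \<longleftrightarrow> ?R")
proof -
  have "?L \<longleftrightarrow> (\<forall>x\<in>X \<inter> A. \<forall>\<epsilon>>0. \<exists>U. openin (subtopology (qm_topology X d) A) U \<and> x \<in> U \<and>
      (\<forall>y\<in>U. \<bar>f x - f y\<bar> < \<epsilon>))"
    \<comment> \<open>Viewing the real line as a metric space gives access to the criterion for
      continuity into a metric space.\<close>
    unfolding mtopology_is_euclidean[symmetric] Met_TC.continuous_map_to_metric
      topspace_subtopology topspace_qm_topology mball_eq_ball mem_ball dist_real_def ..
  also have "\<dots> \<longleftrightarrow> ?R"
  proof (intro ball_cong all_cong refl iffI)
    fix x and \<epsilon> :: real
    assume "\<exists>U. openin (subtopology (qm_topology X d) A) U \<and> x \<in> U \<and> (\<forall>y\<in>U. \<bar>f x - f y\<bar> < \<epsilon>)"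
    then obtain T where T: "openin (qm_topology X d) T" "x \<in> T" "\<forall>y\<in>T \<inter> A. \<bar>f x - f y\<bar> < \<epsilon>"
      unfolding openin_subtopology by blast
    then obtain \<delta> where "0 < \<delta>" "forward_ball X d x \<delta> \<subseteq> T"
      unfolding openin_qm_topology by blast
    with T(3) show "\<exists>\<delta>>0. \<forall>y\<in>X \<inter> A. d x y < \<delta> \<longrightarrow> \<bar>f x - f y\<bar> < \<epsilon>"
      unfolding forward_ball_def by blast
  next
    fix x and \<epsilon> :: real assume x: "x \<in> X \<inter> A"
    assume "\<exists>\<delta>>0. \<forall>y\<in>X \<inter> A. d x y < \<delta> \<longrightarrow> \<bar>f x - f y\<bar> < \<epsilon>"
    then obtain \<delta> where \<delta>: "0 < \<delta>" "\<forall>y\<in>X \<inter> A. d x y < \<delta> \<longrightarrow> \<bar>f x - f y\<bar> < \<epsilon>"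
      by blast
    let ?U = "forward_ball X d x \<delta> \<inter> A"
    have "openin (subtopology (qm_topology X d) A) ?U"
      using openin_forward_ball x \<delta>(1) by (blast intro: openin_subtopology_Int)
    moreover have "x \<in> ?U"
      using x \<delta>(1) self_zero by (simp add: forward_ball_def)
    moreover have "\<forall>y\<in>?U. \<bar>f x - f y\<bar> < \<epsilon>"
      using \<delta>(2) by (simp add: forward_ball_def)
    ultimately show "\<exists>U. openin (subtopology (qm_topology X d) A) U \<and> x \<in> U \<and> (\<forall>y\<in>U. \<bar>f x - f y\<bar> < \<epsilon>)"
      by blast
  qed
  finally show ?thesis .
qed

text \<open>Isolation is required at every point of \<open>X\<close>: a point outside
  \<open>A\<close> then has a ball that misses \<open>A\<close>, since only its centre could lie in
  \<open>A\<close>.\<close>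

lemma closedin_if_isolating:
  assumes "A \<subseteq> X"
    and "\<And>p. p \<in> X \<Longrightarrow> \<exists>\<delta>>0. \<forall>z\<in>A. d p z < \<delta> \<longrightarrow> z = p"
  shows "closedin (qm_topology X d) A"
  unfolding closedin_def topspace_qm_topology openin_qm_topology
proof (intro conjI ballI)
  fix p assume p: "p \<in> X - A"
  then obtain \<delta> where "\<delta> > 0" "\<forall>z\<in>A. d p z < \<delta> \<longrightarrow> z = p"
    using assms(2) by blast
  then show "\<exists>e>0. forward_ball X d p e \<subseteq> X - A"
    using p by (intro exI[of _ \<delta>]) (auto simp: forward_ball_def)
qed (use assms(1) in auto)

end

section \<open>Consequences of the equality of the two topologies\<close>

locale balanced_quasi_metric_space = quasi_metric_space +
  assumes forward_eq_backward: "qm_topology X d = qm_topology X (conjugate d)"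
begin

text \<open>Every forward ball about \<open>p\<close> contains a backward ball about
  \<open>p\<close> and conversely. The \<open>\<delta>\<close> depends on \<open>p\<close>; nothing
  uniform is available.\<close>

lemma forward_iff_backward_small:
  assumes p: "p \<in> X" and "0 < e"
  obtains \<delta> where "0 < \<delta>"
    and "\<And>z. z \<in> X \<Longrightarrow> d p z < \<delta> \<or> d z p < \<delta> \<Longrightarrow> d p z < e \<and> d z p < e"
proof -
  interpret C: quasi_metric_space X "conjugate d"
    by (rule quasi_metric_space_conjugate)
  have "openin (qm_topology X (conjugate d)) (forward_ball X d p e)"
    using openin_forward_ball assms forward_eq_backward by simp
  moreover have "p \<in> forward_ball X d p e"
    using assms self_zero by (simp add: forward_ball_def)
  ultimately obtain \<delta>1 where 1: "\<delta>1 > 0" "forward_ball X (conjugate d) p \<delta>1 \<subseteq> forward_ball X d p e"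
    unfolding C.openin_qm_topology by blast
  have "openin (qm_topology X d) (forward_ball X (conjugate d) p e)"
    using C.openin_forward_ball assms forward_eq_backward by simp
  moreover have "p \<in> forward_ball X (conjugate d) p e"
    using assms C.self_zero by (simp add: forward_ball_def)
  ultimately obtain \<delta>2 where 2: "\<delta>2 > 0" "forward_ball X d p \<delta>2 \<subseteq> forward_ball X (conjugate d) p e"
    unfolding openin_qm_topology by blast
  show thesis
    using 1 2 \<open>0 < e\<close>
    \<comment> \<open>The entry \<open>e\<close> bounds the distance assumed small;
      \<open>\<delta>1\<close> and \<open>\<delta>2\<close> bound the opposite one.\<close>
    by (intro that[of "min e (min \<delta>1 \<delta>2)"]) (auto simp: forward_ball_def conjugate_def)
qed

text \<open>If \<open>d x y = 0\<close> with \<open>x\<close> and \<open>y\<close> distinct, then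
  \<open>d y x > 0\<close> although \<open>y\<close> lies in every forward ball about
  \<open>x\<close>. Smallness in both directions then gives \<open>d y x < d y x\<close>.\<close>

lemma dist_pos:
  assumes "x \<in> X" "y \<in> X" "x \<noteq> y"
  shows "0 < d x y"
proof (rule ccontr)
  assume "\<not> 0 < d x y"
  then have xy: "d x y = 0"
    using nonneg[of x y] assms by simp
  then have "d y x \<noteq> 0"
    using separated assms by blast
  then have "0 < d y x"
    using nonneg[of y x] assms by simp
  then obtain \<delta> where "0 < \<delta>" "\<And>z. z \<in> X \<Longrightarrow> d x z < \<delta> \<or> d z x < \<delta> \<Longrightarrow> d x z < d y x \<and> d z x < d y x"
    using forward_iff_backward_small assms(1) by metis
  then show False
    using xy assms(2) by force
qed

lemma metrizable_qm_topology: "metrizable_space (qm_topology X d)"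
proof -
  \<comment> \<open>The absolute values make \<open>s\<close> nonnegative outside \<open>X\<close>
    too, as \<open>Metric_space\<close> demands.\<close>
  define s where "s x y = \<bar>d x y\<bar> + \<bar>d y x\<bar>" for x y
  have s_eq: "s x y = d x y + d y x" if "x \<in> X" "y \<in> X" for x y
    using that nonneg by (simp add: s_def)
  interpret M: Metric_space X s
  proof
    fix x y z
    show "0 \<le> s x y" "s x y = s y x"
      by (simp_all add: s_def)
    show "s x y = 0 \<longleftrightarrow> x = y" if "x \<in> X" "y \<in> X"
      using dist_pos[of x y] nonneg[of y x] self_zero[of x] that
      by (cases "x = y") (simp_all add: s_eq)
    show "s x z \<le> s x y + s y z" if "x \<in> X" "y \<in> X" "z \<in> X"
      using triangle[of x z y] triangle[of z x y] that by (simp add: s_eq)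
  qed
  have "openin M.mtopology U \<longleftrightarrow> openin (qm_topology X d) U" for U
  proof -
    have "(\<exists>r>0. M.mball x r \<subseteq> U) \<longleftrightarrow> (\<exists>e>0. forward_ball X d x e \<subseteq> U)" if x: "x \<in> X" for x
    proof
      assume "\<exists>r>0. M.mball x r \<subseteq> U"
      then obtain r where r: "r > 0" "M.mball x r \<subseteq> U" by blast
      obtain \<delta> where \<delta>: "0 < \<delta>"
        "\<And>z. z \<in> X \<Longrightarrow> d x z < \<delta> \<or> d z x < \<delta> \<Longrightarrow> d x z < r / 2 \<and> d z x < r / 2"
        using forward_iff_backward_small[OF x, of "r / 2"] r by auto
      have "forward_ball X d x \<delta> \<subseteq> M.mball x r"
      proof
        fix z assume "z \<in> forward_ball X d x \<delta>"
        then show "z \<in> M.mball x r"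
          using \<delta>(2)[of z] x by (auto simp: forward_ball_def M.mball_def s_eq)
      qed
      then show "\<exists>e>0. forward_ball X d x e \<subseteq> U"
        using \<delta> r by blast
    next
      assume "\<exists>e>0. forward_ball X d x e \<subseteq> U"
      then obtain e where e: "e > 0" "forward_ball X d x e \<subseteq> U" by blast
      have "M.mball x e \<subseteq> forward_ball X d x e"
      proof
        fix z assume "z \<in> M.mball x e"
        then show "z \<in> forward_ball X d x e"
          using nonneg[of z x] x by (auto simp: forward_ball_def M.mball_def s_eq)
      qed
      then show "\<exists>r>0. M.mball x r \<subseteq> U"
        using e by blast
    qed
    then show ?thesis
      unfolding M.openin_mtopology openin_qm_topology by blast
  qed
  then have "M.mtopology = qm_topology X d"
    by (simp add: topology_eq)
  then show ?thesis
    using M.metrizable_space_mtopology by simp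
qed

section \<open>From UC to reciprocals\<close>

lemma UC_space_imp_reciprocal:
  assumes UC: "UC_space X d" and A: "closedin (qm_topology X d) A"
    and f: "qm_uniformly_continuous A d f" and nz: "\<forall>x\<in>A. f x \<noteq> 0"
  shows "qm_uniformly_continuous A d (\<lambda>x. 1 / f x)"
proof -
  have AX: "A \<subseteq> X"
    using closedin_subset[OF A] topspace_qm_topology by simp
  have "continuous_map (subtopology (qm_topology X d) A) euclideanreal f"
    unfolding continuous_map_qm_topology
  proof (intro ballI allI impI)
    fix x and \<epsilon> :: real assume "x \<in> X \<inter> A" "0 < \<epsilon>"
    then show "\<exists>\<delta>>0. \<forall>y\<in>X \<inter> A. d x y < \<delta> \<longrightarrow> \<bar>f x - f y\<bar> < \<epsilon>"
      using f unfolding qm_uniformly_continuous_def by (metis IntD2)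
  qed
  then have "continuous_map (subtopology (qm_topology X d) A) euclideanreal (\<lambda>x. 1 / f x)"
    using nz by (intro continuous_map_real_divide) auto
  \<comment> \<open>Metrizability yields the normality that Tietze needs. The target interval is
    \<open>UNIV\<close> because \<open>1 / f\<close> may be unbounded.\<close>
  then obtain g where g: "continuous_map (qm_topology X d) euclideanreal g"
    and gf: "\<And>x. x \<in> A \<Longrightarrow> g x = 1 / f x"
    using Tietze_extension_realinterval[OF metrizable_imp_normal_space[OF metrizable_qm_topology] A,
        of UNIV "\<lambda>x. 1 / f x"]
    by auto
  have "qm_uniformly_continuous X d g"
    using UC g by (simp add: UC_space_def)
  then show ?thesis
    unfolding qm_uniformly_continuous_def using AX gf by (metis subsetD)
qed

section \<open>From reciprocals to UC\<close>

text \<open>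
  An accumulation point of the \<open>x n\<close> would also be one of the \<open>y n\<close> and vice versa, because the
  distances from \<open>p\<close> and to \<open>p\<close> are small simultaneously; continuity of \<open>g\<close> forbids this.
\<close>
lemma separated_sequences_isolating:
  assumes g: "continuous_map (qm_topology X d) euclideanreal g"
    and X: "\<And>n. x n \<in> X" "\<And>n. y n \<in> X"
    and close: "\<And>n::nat. d (x n) (y n) < inverse (real (Suc n))"
    and "0 < \<epsilon>" and far: "\<And>n. \<epsilon> \<le> \<bar>g (x n) - g (y n)\<bar>"
    and p: "p \<in> X"
  obtains \<delta> where "0 < \<delta>"
    and "\<And>z. z \<in> range x \<union> range y \<Longrightarrow> d p z < \<delta> \<or> d z p < \<delta> \<Longrightarrow> z = p"
proof -
  \<comment> \<open>Within radius \<open>r\<close> of \<open>p\<close> the values of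
    \<open>g\<close> differ by less than \<open>\<epsilon>\<close>, so \<open>x n\<close> and
    \<open>y n\<close> cannot both be there.\<close>
  obtain r where r: "0 < r" "\<And>z. z \<in> X \<Longrightarrow> d p z < r \<Longrightarrow> \<bar>g p - g z\<bar> < \<epsilon> / 2"
    using continuous_map_qm_topology[of UNIV g, simplified subtopology_UNIV] g p
      half_gt_zero[OF \<open>0 < \<epsilon>\<close>]
    by (metis Int_UNIV_right)
  obtain \<delta>1 where \<delta>1: "0 < \<delta>1"
    "\<And>z. z \<in> X \<Longrightarrow> d p z < \<delta>1 \<or> d z p < \<delta>1 \<Longrightarrow> d p z < r \<and> d z p < r"
    using forward_iff_backward_small[OF p r(1)] by metis
  \<comment> \<open>The halves leave room for one triangle inequality through
    \<open>d (x n) (y n)\<close>; \<open>\<delta>1\<close> then turns the result into forward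
    distances below \<open>r\<close>.\<close>
  obtain \<delta>2 where \<delta>2: "0 < \<delta>2"
    "\<And>z. z \<in> X \<Longrightarrow> d p z < \<delta>2 \<or> d z p < \<delta>2 \<Longrightarrow> d p z < \<delta>1 / 2 \<and> d z p < \<delta>1 / 2"
    using forward_iff_backward_small[OF p half_gt_zero[OF \<delta>1(1)]] by metis
  obtain N where N: "inverse (real (Suc N)) < \<delta>1 / 2"
    using reals_Archimedean[OF half_gt_zero[OF \<delta>1(1)]] by blast
  have not_both: "\<not> (d p (x n) < r \<and> d p (y n) < r)" for n
    using r(2)[OF X(1), of n] r(2)[OF X(2), of n] far[of n] by linarith
  have tail: "\<not> (d p z < \<delta>2 \<or> d z p < \<delta>2)" if "z = x n \<or> z = y n" "N \<le> n" for z n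
  proof
    assume near: "d p z < \<delta>2 \<or> d z p < \<delta>2"
    have "inverse (real (Suc n)) \<le> inverse (real (Suc N))"
      using that(2) by (simp add: le_imp_inverse_le)
    then have xy: "d (x n) (y n) < \<delta>1 / 2"
      using close[of n] N by linarith
    have z: "d p z < \<delta>1 / 2" "d z p < \<delta>1 / 2"
      using \<delta>2(2)[OF _ near] that(1) X by auto
    \<comment> \<open>Only \<open>d (x n) (y n)\<close> is known to be small, not its reverse, so
      the paths run from \<open>p\<close> via \<open>x n\<close> to \<open>y n\<close>, or from
      \<open>x n\<close> via \<open>y n\<close> to \<open>p\<close>.\<close>
    from that(1) show False
    proof
      assume "z = x n"
      then have "d p (y n) < \<delta>1" "d p (x n) < \<delta>1"
        using triangle[OF p X(2) X(1), of n n] z xy \<delta>1(1) by auto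
      then show False
        using \<delta>1(2) X not_both by blast
    next
      assume "z = y n"
      then have "d (x n) p < \<delta>1" "d (y n) p < \<delta>1"
        using triangle[OF X(1) p X(2), of n n] z xy \<delta>1(1) by auto
      then show False
        using \<delta>1(2) X not_both by blast
    qed
  qed
  \<comment> \<open>The point \<open>p\<close> may itself be a term of the sequences, at distance 0,
    and has to be removed before taking a minimum.\<close>
  define F where "F = (x ` {..<N} \<union> y ` {..<N}) - {p}"
  have "finite F" by (simp add: F_def)
  moreover have "0 < min (d p z) (d z p)" if "z \<in> F" for z
    using that p X by (auto simp: F_def intro!: dist_pos)
  ultimately obtain \<delta>3 where \<delta>3: "0 < \<delta>3" "\<And>z. z \<in> F \<Longrightarrow> \<delta>3 \<le> min (d p z) (d z p)"
    using finite_positive_lower_bound[of F "\<lambda>z. min (d p z) (d z p)"] by blast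
  show thesis
  proof
    show "0 < min \<delta>2 \<delta>3"
      using \<delta>2 \<delta>3 by simp
    fix z assume z: "z \<in> range x \<union> range y" and near: "d p z < min \<delta>2 \<delta>3 \<or> d z p < min \<delta>2 \<delta>3"
    obtain n where n: "z = x n \<or> z = y n"
      using z by blast
    then have "n < N"
      using tail[OF n] near by force
    show "z = p"
    proof (rule ccontr)
      assume "z \<noteq> p"
      then have "z \<in> F"
        using n \<open>n < N\<close> by (auto simp: F_def)
      then show False
        using \<delta>3(2)[of z] near by auto
    qed
  qed
qed

lemma reciprocal_imp_UC_space:
  assumes recip: "\<And>A f. closedin (qm_topology X d) A \<Longrightarrow> qm_uniformly_continuous A d f \<Longrightarrow>
    (\<forall>x\<in>A. f x \<noteq> 0) \<Longrightarrow> qm_uniformly_continuous A d (\<lambda>x. 1 / f x)"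
  shows "UC_space X d"
  unfolding UC_space_def
proof (intro allI impI, rule ccontr)
  fix g assume g: "continuous_map (qm_topology X d) euclideanreal g"
    and not_uc: "\<not> qm_uniformly_continuous X d g"
  obtain \<epsilon> where \<epsilon>: "0 < \<epsilon>"
    "\<And>\<delta>. 0 < \<delta> \<Longrightarrow> \<exists>x\<in>X. \<exists>y\<in>X. d x y < \<delta> \<and> \<epsilon> \<le> \<bar>g x - g y\<bar>"
    using not_uc unfolding qm_uniformly_continuous_def by (meson not_less)
  have "\<exists>x y. x \<in> X \<and> y \<in> X \<and> d x y < inverse (real (Suc n)) \<and> \<epsilon> \<le> \<bar>g x - g y\<bar>" for n
    using \<epsilon>(2)[of "inverse (real (Suc n))"] by auto
  then obtain x y where X: "\<And>n. x n \<in> X" "\<And>n. y n \<in> X"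
    and close: "\<And>n. d (x n) (y n) < inverse (real (Suc n))"
    and far: "\<And>n. \<epsilon> \<le> \<bar>g (x n) - g (y n)\<bar>"
    by metis
  define A where "A = range x \<union> range y"
  define h where "h = to_nat_on A"
  have inj: "inj_on h A"
    unfolding h_def by (rule inj_on_to_nat_on) (simp add: A_def)
  have AX: "A \<subseteq> X"
    using X by (auto simp: A_def)
  have iso: "\<exists>\<delta>>0. \<forall>z\<in>A. d p z < \<delta> \<or> d z p < \<delta> \<longrightarrow> z = p" if "p \<in> X" for p
    using separated_sequences_isolating[OF g X close \<epsilon>(1) far that] unfolding A_def by metis
  \<comment> \<open>The summand 1 keeps the denominator positive where
    \<open>h p = 0\<close>.\<close>
  define f where "f p = 1 / (real (h p) + 1)" for p
  have "closedin (qm_topology X d) A"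
    using iso AX by (intro closedin_if_isolating) blast+
  moreover have "qm_uniformly_continuous A d f"
  proof (rule uniformly_continuous_vanishing_on_discrete)
    show "\<exists>\<delta>>0. \<forall>z\<in>A. d p z < \<delta> \<or> d z p < \<delta> \<longrightarrow> z = p" if "p \<in> A" for p
      using iso AX that by blast
    show "0 < f p" for p
      by (simp add: f_def add_nonneg_pos)
    fix e :: real assume "0 < e"
    \<comment> \<open>A lower bound on \<open>f\<close> is an upper bound on \<open>h\<close>, and
      \<open>h\<close> is injective, so only finitely many points qualify.\<close>
    have "h ` {p \<in> A. e \<le> f p} \<subseteq> {..nat \<lceil>1 / e\<rceil>}"
    proof clarsimp
      fix p assume "e \<le> f p"
      then have "real (h p) + 1 \<le> 1 / e"
        using \<open>0 < e\<close> by (simp add: f_def field_simps)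
      then show "h p \<le> nat \<lceil>1 / e\<rceil>"
        by linarith
    qed
    then have "finite (h ` {p \<in> A. e \<le> f p})"
      by (rule finite_subset) simp
    then show "finite {p \<in> A. e \<le> f p}"
      by (rule finite_imageD) (rule inj_on_subset[OF inj], auto)
  qed
  moreover have "\<forall>p\<in>A. f p \<noteq> 0"
  proof
    show "f p \<noteq> 0" for p
      using of_nat_0_le_iff[of "h p", where 'a = real] by (simp add: f_def)
  qed
  ultimately have "qm_uniformly_continuous A d (\<lambda>p. 1 / f p)"
    by (rule recip)
  \<comment> \<open>Tolerance 1 suffices: \<open>1 / f\<close> is \<open>h + 1\<close>, and natural
    numbers less than 1 apart are equal.\<close>
  then obtain \<delta> where \<delta>: "0 < \<delta>" "\<And>a b. a \<in> A \<Longrightarrow> b \<in> A \<Longrightarrow> d a b < \<delta> \<Longrightarrow> \<bar>1 / f a - 1 / f b\<bar> < 1"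
    unfolding qm_uniformly_continuous_def by (metis zero_less_one)
  obtain n where "inverse (real (Suc n)) < \<delta>"
    using reals_Archimedean[OF \<delta>(1)] by blast
  then have "d (x n) (y n) < \<delta>"
    using close[of n] by linarith
  then have "\<bar>real (h (x n)) - real (h (y n))\<bar> < 1"
    using \<delta>(2)[of "x n" "y n"] by (simp add: A_def f_def)
  then have "h (x n) = h (y n)"
    by linarith
  then have "x n = y n"
    by (rule inj_onD[OF inj]) (simp_all add: A_def)
  then show False
    using far[of n] \<epsilon>(1) by simp
qed

end

theorem theorem5p7:
  fixes X :: "'a set" and d :: "'a \<Rightarrow> 'a \<Rightarrow> real"
  assumes "quasi_metric_space X d"
    and "qm_topology X d = qm_topology X (conjugate d)"
  shows "UC_space X d \<longleftrightarrow>
    (\<forall>A f. closedin (qm_topology X d) A \<longrightarrow> qm_uniformly_continuous A d f \<longrightarrow>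
      (\<forall>x\<in>A. f x \<noteq> 0) \<longrightarrow> qm_uniformly_continuous A d (\<lambda>x. 1 / f x))"
proof -
  interpret balanced_quasi_metric_space X d
    by (intro balanced_quasi_metric_space.intro balanced_quasi_metric_space_axioms.intro assms)
  show ?thesis
    using UC_space_imp_reciprocal reciprocal_imp_UC_space by blast
qed

end
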